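(* Let $\mathcal{Z}(\square)$ be a real Hilbert space, $\mathcal{U}(\square)\subset\mathcal{Z}(\square)$ a closed subspace with orthogonal projection $P_{\mathcal{U}}$, $\mathcal{Y}(\Omega)$ a normed space, and $E_\square\in\mathcal{L}_{\mathrm{is}}(\mathcal{Y}(\Omega),\mathcal{U}(\square))$ with inverse $R_\square:=E_\square^{-1}:\mathcal{U}(\square)\to\mathcal{Y}(\Omega)$. Let $(\cdot,\cdot)_{\square\setminus\Omega}:\mathcal{Z}(\square)\times\mathcal{Z}(\square)\to\mathbb{R}$ be a continuous, symmetric, positive semi-definite bilinear form such that (i) $\mathcal{U}(\square)=\{z\in\mathcal{Z}(\square):(z,z)_{\square\setminus\Omega}=0\}$ and (ii) there is $C_{\mathrm{pen}}>0$ with $\|(I-P_{\mathcal{U}})z\|_{\mathcal{Z}(\square)}\le C_{\mathrm{pen}}(z,z)_{\square\setminus\Omega}^{1/2}$ for all $z\in\mathcal{Z}(\square)$. Let $\tilde R:\mathcal{Z}(\square)\to\mathcal{Y}(\Omega)$ be a continuous linear operator with $\tilde R|_{\mathcal{U}(\square)}=R_\square$. Fix $z\in\mathcal{Z}(\square)$ and suppose that $P_{\mathcal{U}}^\lambda z\to P_{\mathcal{U}}z$ in $\mathcal{Z}(\square)$ as $\lambda\to\infty$. Then for every $r_\Omega\in\mathcal{Y}'(\Omega)$, $$r_\square^\lambda(z)=\big((P_{\mathcal{U}}^\lambda)'\tilde R'r_\Omega\big)(z)\;\longrightarrow\; r_\square^{\mathrm{HB}}(z)\qquad\text{as }\lam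bda\to\infty.$$
   Context: $\mathcal{L}_{\mathrm{is}}(A,B)$ is the set of linear bijections $A\to B$ that are continuous with continuous inverse; $\mathcal{U}(\square)$ carries the norm of $\mathcal{Z}(\square)$. Adjoint: $T'g=g\circ T$. For $\lambda>0$ and $z\in\mathcal{Z}(\square)$, the penalized projection $P_{\mathcal{U}}^\lambda z\in\mathcal{Z}(\square)$ is the unique solution of $(P_{\mathcal{U}}^\lambda z,w)_{\mathcal{Z}(\square)}+\lambda(P_{\mathcal{U}}^\lambda z,w)_{\square\setminus\Omega}=(z,w)_{\mathcal{Z}(\square)}$ for all $w\in\mathcal{Z}(\square)$. For $r_\Omega\in\mathcal{Y}'(\Omega)$ the penalized extension is $r_\square^\lambda(z):=\langle r_\Omega,\tilde R(P_{\mathcal{U}}^\lambda z)\rangle_{\mathcal{Y}(\Omega)}$, and the norm-preserving (Hahn–Banach) extension of $R_\square'r_\Omega\in\mathcal{U}'(\square)$ is $r_\square^{\mathrm{HB}}(z):=\langle r_\Omega,R_\square(P_{\mathcal{U}}z)\rangle_{\mathcal{Y}(\Omega)}$, for $z\in\mathcal{Z}(\square)$. *)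

theory Defs
  imports "HOL-Analysis.Analysis"
begin

text \<open>
  The ambient Hilbert space and the normed space are types; the closed subspace \<open>U\<close> is a set in the
  Hilbert space and carries its norm.
\<close>

text \<open>The set of topological linear isomorphisms from the whole normed space \<open>'a\<close> onto a subspace
  \<open>B\<close>.  On \<open>B = range T\<close> the function \<open>inv T\<close> is the inverse of \<open>T\<close>; off \<open>B\<close> it is irrelevant.\<close>

definition Lis :: "'b set \<Rightarrow> ('a::real_normed_vector \<Rightarrow> 'b::real_normed_vector) set" where
  "Lis B = {T. linear T \<and> bij_betw T UNIV B \<and> continuous_on UNIV T \<and> continuous_on B (inv T)}"

definition orth_proj :: "'a::real_inner set \<Rightarrow> 'a \<Rightarrow> 'a" where
  "orth_proj U z = (THE p. p \<in> U \<and> (\<forall>u\<in>U. (z - p) \<bullet> u = 0))"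

text \<open>The form \<open>b\<close> below is \<open>(\<cdot>,\<cdot>)\<close> on the complement of \<open>\<Omega>\<close> in the box.\<close>

definition pen_proj :: "('a::real_inner \<Rightarrow> 'a \<Rightarrow> real) \<Rightarrow> real \<Rightarrow> 'a \<Rightarrow> 'a" where
  "pen_proj b l z = (THE p. \<forall>w. p \<bullet> w + l * b p w = z \<bullet> w)"

text \<open>The adjoint \<open>T' g = g \<circ> T\<close> on functionals (not the Hilbert space adjoint).\<close>

definition dual_map :: "('a \<Rightarrow> 'b) \<Rightarrow> ('b \<Rightarrow> real) \<Rightarrow> ('a \<Rightarrow> real)" where
  "dual_map T g = g \<circ> T"

definition pen_ext ::
  "('a::real_inner \<Rightarrow> 'a \<Rightarrow> real) \<Rightarrow> ('a \<Rightarrow> 'c::real_normed_vector) \<Rightarrow> ('c \<Rightarrow>\<^sub>L real) \<Rightarrow> real \<Rightarrow> 'a \<Rightarrow> real"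
  where "pen_ext b Rt r l z = blinfun_apply r (Rt (pen_proj b l z))"

definition hb_ext ::
  "'a::real_inner set \<Rightarrow> ('a \<Rightarrow> 'c::real_normed_vector) \<Rightarrow> ('c \<Rightarrow>\<^sub>L real) \<Rightarrow> 'a \<Rightarrow> real"
  where "hb_ext U R r z = blinfun_apply r (R (orth_proj U z))"

end

theory Submission
  imports Defs
begin

text \<open>On \<open>U\<close> the extended restriction operator agrees with the inverse of \<open>E\<close>, so the limit follows
  from continuity once \<open>orth_proj U z\<close> is known to lie in \<open>U\<close>. As it is a definite description, this
  needs the existence of orthogonal projections onto closed subspaces of a Hilbert space.\<close>

text \<open>Cantor's intersection theorem plays the part of a minimizing sequence: the points of
  \<open>U\<close> that nearly realize the distance from \<open>z\<close> form nested closed sets of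
  vanishing diameter. Their common point is nearest to \<open>z\<close>, and minimality along every
  line through it in \<open>U\<close> gives orthogonality.\<close>

lemma orth_proj_exists:
  fixes U :: "'a::{real_inner, complete_space} set"
  assumes "subspace U" and "closed U"
  shows "\<exists>p\<in>U. \<forall>u\<in>U. (z - p) \<bullet> u = 0"
proof -
  define d where "d = infdist z U"
  \<comment> \<open>The slack is added to the squared distance because the parallelogram law
    compares squares.\<close>
  define S where "S n = U \<inter> {u. (dist z u)\<^sup>2 \<le> d\<^sup>2 + inverse (real (Suc n))}" for n
  have U0: "U \<noteq> {}"
    using subspace_0 [OF assms(1)] by blast
  have d0: "d \<ge> 0"
    by (simp add: d_def infdist_nonneg)
  have dle: "d\<^sup>2 \<le> (norm (z - u))\<^sup>2" if "u \<in> U" for u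
    using infdist_le [OF that, of z] d0 by (simp add: d_def dist_norm power_mono)
  have closed_S: "closed (S n)" for n
    unfolding S_def by (intro closed_Int assms(2) closed_Collect_le continuous_intros)
  have S_ne: "S n \<noteq> {}" for n
  proof -
    \<comment> \<open>The infimum is not yet known to be attained, so the strictly positive slack is
      what supplies a point.\<close>
    have "d < sqrt (d\<^sup>2 + inverse (real (Suc n)))"
      by (rule real_less_rsqrt) simp
    then obtain u where u: "u \<in> U" "dist z u < sqrt (d\<^sup>2 + inverse (real (Suc n)))"
      using U0 by (auto simp: d_def infdist_notempty cINF_less_iff)
    have "(dist z u)\<^sup>2 \<le> (sqrt (d\<^sup>2 + inverse (real (Suc n))))\<^sup>2"
      using u(2) by (intro power_mono) auto
    then show ?thesis
      using u(1) by (auto simp: S_def)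
  qed
  have S_mono: "S n \<subseteq> S m" if "m \<le> n" for m n
  proof -
    have "inverse (real (Suc n)) \<le> inverse (real (Suc m))"
      using that by (simp add: field_simps)
    then have "e \<le> d\<^sup>2 + inverse (real (Suc m))" if "e \<le> d\<^sup>2 + inverse (real (Suc n))" for e
      using that by linarith
    then show ?thesis
      unfolding S_def by blast
  qed
  have S_diam: "(dist x y)\<^sup>2 \<le> 4 * inverse (real (Suc n))" if "x \<in> S n" "y \<in> S n" for x y n
  proof -
    have "(1/2) *\<^sub>R (x + y) \<in> U"
      using that assms(1) by (auto simp: S_def intro: subspace_scale subspace_add)
    note mid = dle [OF this]
    \<comment> \<open>Parallelogram law for \<open>z - x\<close> and \<open>z - y\<close>. The first
      two terms add up to at most \<open>4 * d\<^sup>2\<close> plus four times the slack; since the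
      midpoint lies in \<open>U\<close>, the last removes at least
      \<open>4 * d\<^sup>2\<close>.\<close>
    have "(dist x y)\<^sup>2 = 2 * (norm (z - x))\<^sup>2 + 2 * (norm (z - y))\<^sup>2
        - 4 * (norm (z - (1/2) *\<^sub>R (x + y)))\<^sup>2"
      by (simp add: dist_norm power2_norm_eq_inner inner_diff_left inner_diff_right inner_add_left
          inner_add_right inner_commute field_simps)
    then show ?thesis
      using mid that by (simp add: S_def dist_norm)
  qed
  have S_small: "\<exists>n. \<forall>x\<in>S n. \<forall>y\<in>S n. dist x y < e" if "e > 0" for e
  proof -
    \<comment> \<open>Dividing by 4 cancels the factor in \<open>S_diam\<close>.\<close>
    obtain n where n: "inverse (real (Suc n)) < e\<^sup>2 / 4"
      using reals_Archimedean [of "e\<^sup>2 / 4"] \<open>e > 0\<close>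
      by (metis divide_pos_pos zero_less_power zero_less_numeral)
    have "dist x y < e" if "x \<in> S n" "y \<in> S n" for x y
      using S_diam [OF that] n \<open>e > 0\<close> by (intro power2_less_imp_less [of _ e]) auto
    then show ?thesis
      by blast
  qed
  obtain p where p: "\<And>n. p \<in> S n"
    using decreasing_closed_nest [OF closed_S S_ne S_mono S_small] by blast
  have pU: "p \<in> U"
    using p by (auto simp: S_def)
  have p_min: "(norm (z - p))\<^sup>2 \<le> d\<^sup>2"
  proof (rule field_le_epsilon)
    fix e :: real assume "e > 0"
    then obtain n where "inverse (real (Suc n)) < e"
      using reals_Archimedean by blast
    then show "(norm (z - p))\<^sup>2 \<le> d\<^sup>2 + e"
      using p [of n] by (simp add: S_def dist_norm)
  qed
  have "(z - p) \<bullet> u = 0" if u: "u \<in> U" for u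
  proof (cases "u = 0")
    case False
    define c where "c = (z - p) \<bullet> u"
    \<comment> \<open>This \<open>t\<close> minimizes the quadratic
      \<open>(norm ((z - p) - t *\<^sub>R u))\<^sup>2\<close>. It lowers the value at 0 by
      \<open>c\<^sup>2 / (u \<bullet> u)\<close>, which minimality of \<open>p\<close> allows only
      if \<open>c = 0\<close>.\<close>
    define t where "t = c / (u \<bullet> u)"
    have "p + t *\<^sub>R u \<in> U"
      using pU u assms(1) by (auto intro: subspace_scale subspace_add)
    then have "(norm (z - p))\<^sup>2 \<le> (norm ((z - p) - t *\<^sub>R u))\<^sup>2"
      using dle [of "p + t *\<^sub>R u"] p_min unfolding diff_diff_eq by linarith
    also have "\<dots> = (norm (z - p))\<^sup>2 - 2 * t * c + t\<^sup>2 * (u \<bullet> u)"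
      unfolding c_def power2_norm_eq_inner
      by (simp add: inner_commute algebra_simps power2_eq_square)
    also have "\<dots> = (norm (z - p))\<^sup>2 - c\<^sup>2 / (u \<bullet> u)"
      using False by (simp add: t_def field_simps power2_eq_square)
    finally have "c\<^sup>2 / (u \<bullet> u) \<le> 0"
      by simp
    moreover have "u \<bullet> u > 0"
      using False by simp
    ultimately show ?thesis
      unfolding c_def divide_le_0_iff by (auto simp del: inner_gt_zero_iff)
  qed simp
  with pU show ?thesis
    by blast
qed

lemma orth_proj_in:
  fixes U :: "'a::{real_inner, complete_space} set"
  assumes "subspace U" and "closed U"
  shows "orth_proj U z \<in> U"
proof -
  obtain p where p: "p \<in> U" "\<forall>u\<in>U. (z - p) \<bullet> u = 0"
    using orth_proj_exists [OF assms] by blast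
  have "q = p" if q: "q \<in> U" "\<forall>u\<in>U. (z - q) \<bullet> u = 0" for q
  proof -
    have "q - p \<in> U"
      using q(1) p(1) assms(1) by (simp add: subspace_diff)
    \<comment> \<open>Uniqueness: both orthogonality conditions are tested with
      \<open>q - p\<close>, and their difference is its squared norm.\<close>
    then have "(z - p) \<bullet> (q - p) - (z - q) \<bullet> (q - p) = 0"
      using p(2) q(2) by simp
    then have "(q - p) \<bullet> (q - p) = 0"
      by (simp add: inner_diff_left)
    then show ?thesis
      by simp
  qed
  with p have "\<exists>!p. p \<in> U \<and> (\<forall>u\<in>U. (z - p) \<bullet> u = 0)"
    by (intro ex1I [of _ p]) blast+
  from theI' [OF this] show ?thesis
    unfolding orth_proj_def by (rule conjunct1)
qed

theorem corollary3p19: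
  fixes U :: "'z::{real_inner, complete_space} set"
    and E :: "'y::real_normed_vector \<Rightarrow> 'z"
    and b :: "'z \<Rightarrow> 'z \<Rightarrow> real"
    and Rt :: "'z \<Rightarrow> 'y"
    and z :: 'z
    and r :: "'y \<Rightarrow>\<^sub>L real"
  assumes "subspace U" and "closed U"
    and "E \<in> Lis U"
    and "bounded_bilinear b"
    and "\<And>x y. b x y = b y x"
    and "\<And>x. b x x \<ge> 0"
    and "U = {x. b x x = 0}"
    and "\<exists>C>0. \<forall>x. norm (x - orth_proj U x) \<le> C * sqrt (b x x)"
    and "bounded_linear Rt"
    and "\<And>u. u \<in> U \<Longrightarrow> Rt u = inv E u"
    and "((\<lambda>l. pen_proj b l z) \<longlongrightarrow> orth_proj U z) at_top"
  shows "(\<forall>l>0. pen_ext b Rt r l z = dual_map (pen_proj b l) (dual_map Rt (blinfun_apply r)) z)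
    \<and> ((\<lambda>l. pen_ext b Rt r l z) \<longlongrightarrow> hb_ext U (inv E) r z) at_top"
proof -
  have proj: "orth_proj U z \<in> U"
    by (rule orth_proj_in [OF assms(1,2)])
  have "((\<lambda>l. Rt (pen_proj b l z)) \<longlongrightarrow> Rt (orth_proj U z)) at_top"
    by (rule bounded_linear.tendsto [OF assms(9,11)])
  then have "((\<lambda>l. pen_ext b Rt r l z) \<longlongrightarrow> r (Rt (orth_proj U z))) at_top"
    unfolding pen_ext_def
    by (rule bounded_linear.tendsto [OF blinfun.bounded_linear_right])
  then show ?thesis
    \<comment> \<open>Membership in \<open>U\<close> turns \<open>Rt\<close> into
      \<open>inv E\<close> at the limit point; the first conjunct is only the unfolding of both
      adjoints.\<close>
    using assms(10) [OF proj] by (simp add: hb_ext_def pen_ext_def dual_map_def)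
qed

end
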